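(* Let $d\ge2$ and $m\ge 2$ be integers, let $0<r<1$, and let $K\subset\mathbb R^d$ be the attractor of an iterated function system $\{f_i(x)=rx+\lambda_i\}_{i=0}^{m-1}$ with $\lambda_i\in\mathbb R^d$. If \[-\log_2 r>\log_2 m-\frac2m,\] then there are a finite collection $\mathcal V\subset\mathbb R^d\setminus\{0\}$ of directions and a cover $(E_v)_{v\in\mathcal V}$ of $K$ such that, for each $v\in\mathcal V$, the orthogonal projection of $E_v$ onto the line spanned by $v$ has Hausdorff dimension at most \[\frac{\log_2 m-2/m}{-\log_2 r}<1.\] In particular, $K$ is tube-null.
   Context: The attractor of $\{f_i\}$ is the unique non-empty compact set $K$ with $K=\bigcup_i f_i(K)$. A tube $T$ of width $w=w(T)>0$ is the $w$-neighborhood of a line in $\mathbb R^d$. A set $K\subset\mathbb R^d$ is tube-null if for every $\varepsilon>0$ there is a countable family of tubes $\{T_i\}$ with $K\subset\bigcup_iT_i$ and $\sum_i w(T_i)^{d-1}<\varepsilon$. No separation condition on the pieces $f_i(K)$ is assumed. *)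

theory Defs
  imports "HOL-Analysis.Analysis"
begin

text \<open>Uniqueness and existence of the attractor are Hutchinson's theorem for finitely many
  contractions and are not part of the predicate.\<close>

definition is_attractor :: "'i set \<Rightarrow> ('i \<Rightarrow> 'a \<Rightarrow> 'a) \<Rightarrow> 'a::metric_space set \<Rightarrow> bool" where
  "is_attractor I f K \<longleftrightarrow> compact K \<and> K \<noteq> {} \<and> K = (\<Union>i\<in>I. f i ` K)"

definition is_tube :: "real \<Rightarrow> 'a::euclidean_space set \<Rightarrow> bool" where
  "is_tube w T \<longleftrightarrow>
     w > 0 \<and> (\<exists>L. affine L \<and> aff_dim L = 1 \<and> T = {x. infdist x L < w})"

text \<open>Countable families are indexed by arbitrary sets of naturals, so finite families are allowed.\<close>

definition tube_null :: "'a::euclidean_space set \<Rightarrow> bool" where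
  "tube_null K \<longleftrightarrow>
     (\<forall>\<epsilon>>0. \<exists>(I :: nat set) T w.
        (\<forall>i\<in>I. is_tube (w i) (T i)) \<and> K \<subseteq> (\<Union>i\<in>I. T i) \<and>
        (\<lambda>i. w i ^ (DIM('a) - 1)) summable_on I \<and>
        (\<Sum>\<^sub>\<infinity>i\<in>I. w i ^ (DIM('a) - 1)) < (\<epsilon>::real))"

text \<open>\<open>diam(U)^s\<close> with the convention \<open>diam(U)^0 = 1\<close> for nonempty \<open>U\<close>; note that
  \<open>0 powr 0 = 0\<close> in HOL.\<close>

definition diam_pow :: "real \<Rightarrow> 'a::metric_space set \<Rightarrow> ennreal" where
  "diam_pow s U =
     (if U = {} then 0 else if s = 0 then 1 else ennreal (diameter U powr s))"

text \<open>Boundedness is required explicitly because \<open>diameter\<close> is real-valued and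
  unspecified on unbounded sets.\<close>

definition hausdorff_premeasure :: "real \<Rightarrow> real \<Rightarrow> 'a::metric_space set \<Rightarrow> ennreal" where
  "hausdorff_premeasure s \<delta> A =
     (INF U \<in> {U :: nat \<Rightarrow> 'a set. A \<subseteq> (\<Union>i. U i) \<and> (\<forall>i. bounded (U i) \<and> diameter (U i) \<le> \<delta>)}.
        \<Sum>i. diam_pow s (U i))"

definition hausdorff_measure :: "real \<Rightarrow> 'a::metric_space set \<Rightarrow> ennreal" where
  "hausdorff_measure s A = (SUP \<delta> \<in> {0<..}. hausdorff_premeasure s \<delta> A)"

definition hausdorff_dim :: "'a::metric_space set \<Rightarrow> ereal" where
  "hausdorff_dim A = Inf {ereal s |s. 0 \<le> s \<and> hausdorff_measure s A = 0}"

definition line_proj :: "'a::real_inner \<Rightarrow> 'a \<Rightarrow> 'a" where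
  "line_proj v x = ((x \<bullet> v) / (v \<bullet> v)) *\<^sub>R v"

lemma line_proj_in_span: "line_proj v x \<in> span {v}"
  by (simp add: line_proj_def span_base span_scale)

lemma line_proj_orthogonal: "y \<in> span {v} \<Longrightarrow> orthogonal (x - line_proj v x) y"
  by (cases "v = 0") (auto simp: span_singleton orthogonal_def line_proj_def inner_diff_left)

end

theory Submission
  imports Defs
begin

text \<open>
  In every word of length \<open>n\<close> over \<open>m\<close> letters some two letters \<open>i \<noteq> j\<close> together occur at least
  \<open>2n/m\<close> times. Projecting to a direction \<open>v\<close> orthogonal to \<open>\<lambda>\<^sub>i - \<lambda>\<^sub>j\<close> identifies these two letters.
  Give the merged letter weight 2 and every other letter weight 1; the total weight of all merged
  words of length \<open>n\<close> is \<open>m\<^sup>n\<close>, so at most \<open>q\<^sup>n\<close> of them, with \<open>q = m 2\<^bsup>-2/m\<^esup>\<close>, contain the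
  merged letter \<open>2n/m\<close> times. Hence the points of \<open>K\<close> for which the pair \<open>(i, j)\<close> can be used at
  infinitely many levels project to a set of dimension at most \<open>log q / (- log r)\<close>. The hypothesis
  says \<open>q r < 1\<close>. At level \<open>n\<close> the set \<open>K\<close> is covered by \<open>O(q\<^sup>n)\<close> bounded slabs of thickness about
  \<open>r\<^sup>n\<close>, each of which is covered by \<open>O(r\<^bsup>-n(d-2)\<^esup>)\<close> tubes of that width, and this makes \<open>K\<close>
  tube-null.
\<close>

section \<open>Counting words by letter frequencies\<close>

lemma sum_prod_list_lists_length:
  fixes f :: "'a \<Rightarrow> 'b::comm_semiring_1"
  assumes "finite A"
  shows "(\<Sum>u | set u \<subseteq> A \<and> length u = n. prod_list (map f u)) = (\<Sum>a\<in>A. f a) ^ n"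
proof (induction n)
  case 0
  have "{u. set u \<subseteq> A \<and> length u = 0} = {[]}" by auto
  then show ?case by simp
next
  case (Suc n)
  let ?L = "{u. set u \<subseteq> A \<and> length u = n}"
  have "(\<Sum>u | set u \<subseteq> A \<and> length u = Suc n. prod_list (map f u))
      = (\<Sum>(u, a)\<in>?L \<times> A. prod_list (map f u) * f a)"
    unfolding lists_length_Suc_eq
    by (subst sum.reindex) (auto simp: inj_on_def case_prod_unfold mult.commute)
  also have "\<dots> = (\<Sum>u\<in>?L. prod_list (map f u)) * (\<Sum>a\<in>A. f a)"
    by (simp add: sum_product sum.cartesian_product)
  finally show ?case using Suc by (simp add: mult.commute)
qed

lemma prod_list_map_eq_power_count_list:
  fixes c :: "'b::comm_monoid_mult"
  shows "prod_list (map (\<lambda>a. if a = b then c else 1) u) = c ^ count_list u b"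
  by (induction u) (auto simp: mult_ac)

text \<open>An exponential Markov inequality: with weight \<open>2 ^ count_list u b\<close>, each
  counted word weighs at least \<open>2 powr k\<close>, while all words of length \<open>n\<close>
  together weigh \<open>(card A + 1) ^ n\<close>.\<close>

lemma card_lists_count_list_ge:
  assumes "finite A" "b \<in> A"
  shows "real (card {u. set u \<subseteq> A \<and> length u = n \<and> k \<le> real (count_list u b)})
    \<le> real (card A + 1) ^ n * 2 powr (- k)"
proof -
  let ?L = "{u. set u \<subseteq> A \<and> length u = n}"
  let ?S = "{u. set u \<subseteq> A \<and> length u = n \<and> k \<le> real (count_list u b)}"
  have fin: "finite ?L" using finite_lists_length_eq[OF assms(1)] by simp
  have "real (card ?S) * 2 powr k = (\<Sum>u\<in>?S. 2 powr k)" by simp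
  also have "\<dots> \<le> (\<Sum>u\<in>?S. 2 ^ count_list u b)"
    by (rule sum_mono) (auto simp flip: powr_realpow)
  also have "\<dots> \<le> (\<Sum>u\<in>?L. 2 ^ count_list u b)"
    by (rule sum_mono2[OF fin]) auto
  also have "\<dots> = (\<Sum>u\<in>?L. prod_list (map (\<lambda>a. if a = b then 2 else 1) u))"
    by (simp add: prod_list_map_eq_power_count_list)
  also have "\<dots> = (\<Sum>a\<in>A. if a = b then 2 else 1) ^ n"
    by (rule sum_prod_list_lists_length[OF assms(1)])
  also have "(\<Sum>a\<in>A. if a = b then 2 else 1 :: real) = real (card A + 1)"
  proof -
    have "0 < card A" using assms by (auto simp: card_gt_0_iff)
    then show ?thesis
      by (simp add: sum.remove[OF assms] sum.If_cases of_nat_diff assms)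
  qed
  finally show ?thesis by (simp add: powr_minus field_simps)
qed

text \<open>It suffices to average over the \<open>m\<close> cyclically adjacent pairs: every letter
  lies in two of them, so their counts add up to twice the length of the word.\<close>

lemma ex_pair_count_list_ge:
  fixes u :: "nat list"
  assumes "m \<ge> 2" "set u \<subseteq> {0..<m}"
  obtains i j where "i < m" "j < m" "i \<noteq> j"
    "2 * real (length u) / real m \<le> real (count_list u i + count_list u j)"
proof -
  define c where "c = count_list u"
  obtain k where k: "m = Suc k" "k \<ge> 1" using assms(1) by (cases m) auto
  have sum_c: "(\<Sum>i<m. c i) = length u"
    unfolding c_def using assms(2) by (intro sum_count_set) auto
  \<comment> \<open>The cyclic shift permutes the letters; only the last index wraps around, to
    0.\<close>
  have "(\<Sum>i<m. c (Suc i mod m)) = (\<Sum>i<m. c i)"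
  proof -
    have "(\<Sum>i<m. c (Suc i mod m)) = (\<Sum>i<k. c (Suc i)) + c 0"
      by (simp add: k)
    also have "\<dots> = (\<Sum>i<m. c i)" unfolding k(1) sum.lessThan_Suc_shift by simp
    finally show ?thesis .
  qed
  then have sum2: "(\<Sum>i<m. c i + c (Suc i mod m)) = 2 * length u"
    by (simp add: sum.distrib sum_c)
  have "\<exists>i<m. 2 * real (length u) / real m \<le> real (c i + c (Suc i mod m))"
  proof (rule ccontr)
    assume "\<not> ?thesis"
    then have "(\<Sum>i<m. real (c i + c (Suc i mod m))) < (\<Sum>i<m. 2 * real (length u) / real m)"
      by (intro sum_strict_mono) (use k in auto)
    also have "\<dots> = 2 * real (length u)" using k by simp
    also have "\<dots> = (\<Sum>i<m. real (c i + c (Suc i mod m)))"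
      unfolding of_nat_sum[symmetric] sum2 by simp
    finally show False by simp
  qed
  then obtain i where i: "i < m" "2 * real (length u) / real m \<le> real (c i + c (Suc i mod m))"
    by blast
  have "i \<noteq> Suc i mod m"
    using i(1) assms(1) by (cases "Suc i = m") auto
  with i show ?thesis using that[of i "Suc i mod m"] assms(1) by (simp add: c_def)
qed

section \<open>Coding points of the attractor by words and merging two letters\<close>

text \<open>This is the image of 0 under the composition of the maps along the word, with the head
  letter outermost; the whole composition is this translation added to scaling by
  \<open>r ^ length u\<close>.\<close>

fun word_shift :: "real \<Rightarrow> ('i \<Rightarrow> 'a::real_vector) \<Rightarrow> 'i list \<Rightarrow> 'a" where
  "word_shift r lam [] = 0"
| "word_shift r lam (a # u) = lam a + r *\<^sub>R word_shift r lam u"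

lemma attractor_word:
  assumes "is_attractor I (\<lambda>i x. r *\<^sub>R x + lam i) K" "x \<in> K"
  shows "\<exists>u y. set u \<subseteq> I \<and> length u = n \<and> y \<in> K \<and> x = r ^ n *\<^sub>R y + word_shift r lam u"
  using assms(2)
proof (induction n arbitrary: x)
  case 0
  then show ?case by (intro exI[of _ "[]"] exI[of _ x]) auto
next
  case (Suc n)
  from assms(1) Suc.prems obtain i z where iz: "i \<in> I" "z \<in> K" "x = r *\<^sub>R z + lam i"
    unfolding is_attractor_def by blast
  from Suc.IH[OF iz(2)] obtain u y where
    "set u \<subseteq> I" "length u = n" "y \<in> K" "z = r ^ n *\<^sub>R y + word_shift r lam u" by blast
  with iz show ?case
    by (intro exI[of _ "i # u"] exI[of _ y]) (auto simp: algebra_simps)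
qed

lemma inner_word_shift_map:
  assumes "\<And>a. lam (g a) \<bullet> v = lam a \<bullet> v"
  shows "word_shift r lam (map g u) \<bullet> v = word_shift r lam u \<bullet> v"
  by (induction u) (simp_all add: inner_add_left assms)

lemma count_list_map_merge:
  assumes "i \<noteq> j"
  shows "count_list (map (\<lambda>a. if a = j then i else a) u) i = count_list u i + count_list u j"
  using assms by (induction u) auto

text \<open>Triples \<open>(i, j, w)\<close> where in the word \<open>w\<close> the letter \<open>j\<close> has been replaced by \<open>i\<close>,
  so that \<open>i\<close> stands for two letters.\<close>

definition merged_words :: "nat \<Rightarrow> nat \<Rightarrow> (nat \<times> nat \<times> nat list) set" where
  "merged_words m n = (SIGMA i:{0..<m}. SIGMA j:{0..<m} - {i}.
    {w. set w \<subseteq> {0..<m} - {j} \<and> length w = n \<and> 2 * real n / real m \<le> real (count_list w i)})"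

lemma finite_merged_words: "finite (merged_words m n)"
  unfolding merged_words_def
  by (intro finite_SigmaI) (auto intro: finite_subset[OF _ finite_lists_length_eq[of "{0..<m}" n]])

lemma card_merged_words:
  "real (card (merged_words m n)) \<le> real (m ^ 2) * (real m * 2 powr (- 2 / real m)) ^ n"
proof -
  let ?q = "(real m * 2 powr (- 2 / real m)) ^ n"
  let ?W = "\<lambda>i j. {w. set w \<subseteq> {0..<m} - {j} \<and> length w = n \<and>
    2 * real n / real m \<le> real (count_list w i)}"
  have fin: "finite (?W i j)" for i j
    by (rule finite_subset[OF _ finite_lists_length_eq[of "{0..<m}" n]]) auto
  have le: "real (card (?W i j)) \<le> ?q" if "i < m" "j < m" "j \<noteq> i" for i j
  proof -
    have "real (card (?W i j))
      \<le> real (card ({0..<m} - {j}) + 1) ^ n * 2 powr (- (2 * real n / real m))"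
      by (rule card_lists_count_list_ge) (use that in auto)
    \<comment> \<open>Deleting \<open>j\<close> loses one letter and the double weight of
      \<open>i\<close> restores it, so the base is exactly \<open>m\<close>.\<close>
    also have "card ({0..<m} - {j}) + 1 = m" using that by simp
    also have "2 powr (- (2 * real n / real m)) = (2 powr (- 2 / real m)) ^ n"
      by (simp add: powr_power mult.commute)
    finally show ?thesis by (simp add: power_mult_distrib)
  qed
  have "real (card (merged_words m n)) = (\<Sum>i\<in>{0..<m}. \<Sum>j\<in>{0..<m} - {i}. real (card (?W i j)))"
    unfolding merged_words_def using fin by (subst card_SigmaI) (auto intro!: finite_SigmaI)
  also have "\<dots> \<le> (\<Sum>i\<in>{0..<m}. \<Sum>j\<in>{0..<m} - {i}. ?q)"
    by (intro sum_mono le) auto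
  also have "\<dots> \<le> (\<Sum>i\<in>{0..<m}. \<Sum>j\<in>{0..<m}. ?q)"
    by (intro sum_mono sum_mono2) auto
  also have "\<dots> = real (m ^ 2) * ?q" by (simp add: power2_eq_square)
  finally show ?thesis .
qed

text \<open>A direction with equal inner products against \<open>lam i\<close> and
  \<open>lam j\<close> cannot tell the two letters apart, so a code of \<open>x\<close> may be
  merged without moving its projection; the error is the projection of the scaled remainder
  \<open>r ^ n *\<^sub>R y\<close>. The pair may change with \<open>n\<close>, which is why limsup
  sets appear below.\<close>

lemma attractor_merged_word:
  assumes "is_attractor {0..<m} (\<lambda>i x. r *\<^sub>R x + lam i) K" "m \<ge> 2" "x \<in> K" "0 < r"
    and R: "\<And>y. y \<in> K \<Longrightarrow> norm y \<le> R"
  shows "\<exists>i j w. (i, j, w) \<in> merged_words m n \<and>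
    (\<forall>v. norm v = 1 \<longrightarrow> lam i \<bullet> v = lam j \<bullet> v \<longrightarrow>
      \<bar>x \<bullet> v - word_shift r lam w \<bullet> v\<bar> \<le> R * r ^ n)"
proof -
  obtain u y where u: "set u \<subseteq> {0..<m}" "length u = n" and y: "y \<in> K"
    and x: "x = r ^ n *\<^sub>R y + word_shift r lam u"
    using attractor_word[OF assms(1,3), of n] by blast
  obtain i j where ij: "i < m" "j < m" "i \<noteq> j"
    and cnt: "2 * real n / real m \<le> real (count_list u i + count_list u j)"
    using ex_pair_count_list_ge[OF assms(2) u(1)] u(2) by auto
  let ?g = "\<lambda>a. if a = j then i else a"
  show ?thesis
  proof (intro exI conjI allI impI)
    have "set (map ?g u) \<subseteq> {0..<m} - {j}" using u(1) ij by auto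
    then show "(i, j, map ?g u) \<in> merged_words m n"
      using u(2) cnt ij by (simp add: merged_words_def count_list_map_merge)
    fix v :: 'a assume v: "norm v = 1" "lam i \<bullet> v = lam j \<bullet> v"
    have "x \<bullet> v - word_shift r lam (map ?g u) \<bullet> v = r ^ n * (y \<bullet> v)"
      using v by (subst inner_word_shift_map) (auto simp: x inner_add_left)
    moreover have "\<bar>y \<bullet> v\<bar> \<le> R" using Cauchy_Schwarz_ineq2[of y v] R[OF y] v by simp
    ultimately show "\<bar>x \<bullet> v - word_shift r lam (map ?g u) \<bullet> v\<bar> \<le> R * r ^ n"
      using assms(4) by (simp add: abs_mult mult.commute mult_right_mono)
  qed
qed

section \<open>Hausdorff dimension of limsup sets\<close>

text \<open>A Borel-Cantelli argument: every tail of the families covers \<open>A\<close>, since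
  each point is hit at infinitely many levels, and the cost of a tail is bounded by the tail of a
  geometric series of ratio \<open>q * r powr s\<close>.\<close>

lemma hausdorff_premeasure_limsup_eq_0:
  fixes A :: "'a::metric_space set" and \<U> :: "nat \<Rightarrow> 'a set set"
  assumes fin: "\<And>n. finite (\<U> n)" and card: "\<And>n. real (card (\<U> n)) \<le> C * q ^ n"
    and bdd: "\<And>n U. U \<in> \<U> n \<Longrightarrow> bounded U"
    and diam: "\<And>n U. U \<in> \<U> n \<Longrightarrow> diameter U \<le> c * r ^ n"
    and cover: "\<And>x. x \<in> A \<Longrightarrow> \<exists>\<^sub>\<infinity>n. x \<in> \<Union>(\<U> n)"
    and C: "0 \<le> C" and c: "0 < c" and q: "0 < q" and r: "0 < r" "r < 1"
    and s: "0 < s" "q * r powr s < 1" and \<delta>: "0 < \<delta>"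
  shows "hausdorff_premeasure s \<delta> A = 0"
proof -
  define a where "a n = C * c powr s * (q * r powr s) ^ n" for n :: nat
  have \<rho>: "0 \<le> q * r powr s" using q by simp
  have a_nonneg: "0 \<le> a n" for n using C \<rho> by (simp add: a_def)
  have a_sum: "summable a"
    unfolding a_def using s(2) \<rho> by (intro summable_mult summable_geometric) auto
  have le: "hausdorff_premeasure s \<delta> A \<le> ennreal \<epsilon>" if \<epsilon>: "0 < \<epsilon>" for \<epsilon>
  proof -
    have "(\<lambda>n. c * r ^ n) \<longlonglongrightarrow> 0"
      using r by (intro tendsto_mult_right_zero LIMSEQ_realpow_zero) auto
    then have "\<forall>\<^sub>F n in sequentially. c * r ^ n < \<delta>"
      using \<delta> by (simp add: order_tendsto_iff)
    moreover have "\<forall>\<^sub>F n in sequentially. (\<Sum>k. a (k + n)) < \<epsilon>"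
      using suminf_exist_split2[OF a_sum] \<epsilon> by (simp add: order_tendsto_iff)
    ultimately have "\<forall>\<^sub>F n in sequentially. (\<forall>k\<ge>n. c * r ^ k < \<delta>) \<and> (\<Sum>k. a (k + n)) < \<epsilon>"
      by (intro eventually_conj) (auto intro: eventually_all_ge_at_top)
    then obtain N where N\<delta>: "\<And>k. k \<ge> N \<Longrightarrow> c * r ^ k < \<delta>" and N\<epsilon>: "(\<Sum>k. a (k + N)) < \<epsilon>"
      by (auto simp: eventually_sequentially)
    have "\<exists>e. bij_betw e {..<card (\<U> n)} (\<U> n)" for n
      using ex_bij_betw_nat_finite[OF fin[of n]] by (simp add: atLeast0LessThan)
    then obtain e where e: "\<And>n. bij_betw (e n) {..<card (\<U> n)} (\<U> n)" by metis
    \<comment> \<open>Each finite family is padded to a sequence with empty sets, which cost nothing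
      under \<open>diam_pow\<close>; \<open>prod_decode\<close> then turns the double sequence into
      one cover indexed by the naturals.\<close>
    define F where "F n l = (if l < card (\<U> (n + N)) then e (n + N) l else {})" for n l
    have F_in: "F n l \<in> \<U> (n + N)" if "l < card (\<U> (n + N))" for n l
      using bij_betwE[OF e[of "n + N"]] that by (auto simp: F_def)
    define U where "U = (\<lambda>k. case prod_decode k of (n, l) \<Rightarrow> F n l)"
    have "A \<subseteq> (\<Union>k. U k)"
    proof
      fix x assume "x \<in> A"
      then obtain n where "n \<ge> N" "x \<in> \<Union>(\<U> n)"
        using cover[of x] unfolding INFM_nat_le by blast
      then obtain l where "l < card (\<U> n)" "x \<in> e n l"
        using bij_betw_imp_surj_on[OF e[of n]] by (metis UnionE imageE lessThan_iff)
      with \<open>n \<ge> N\<close> have "x \<in> U (prod_encode (n - N, l))"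
        by (simp add: U_def F_def)
      then show "x \<in> (\<Union>k. U k)" by blast
    qed
    moreover have "bounded (F n l) \<and> diameter (F n l) \<le> \<delta>" for n l
    proof (cases "l < card (\<U> (n + N))")
      case True
      then show ?thesis
        using bdd[OF F_in[OF True]] diam[OF F_in[OF True]] N\<delta>[of "n + N"] by force
    next
      case False
      then show ?thesis using \<delta> by (simp add: F_def)
    qed
    then have "bounded (U k) \<and> diameter (U k) \<le> \<delta>" for k
      by (simp add: U_def split: prod.split)
    ultimately have "hausdorff_premeasure s \<delta> A \<le> (\<Sum>k. diam_pow s (U k))"
      unfolding hausdorff_premeasure_def by (intro INF_lower) auto
    also have "\<dots> = (\<Sum>n. \<Sum>l. diam_pow s (F n l))"
    proof -
      have "(\<Sum>k. case_prod (\<lambda>n l. diam_pow s (F n l)) (prod_decode k))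
        = (\<Sum>n. \<Sum>l. diam_pow s (F n l))"
        by (rule suminf_ennreal_2dimen) simp
      then show ?thesis by (simp add: U_def case_prod_unfold)
    qed
    also have "\<dots> \<le> (\<Sum>n. ennreal (a (n + N)))"
    proof (rule suminf_le)
      fix n
      let ?k = "card (\<U> (n + N))"
      have "(\<Sum>l. diam_pow s (F n l)) = (\<Sum>l<?k. diam_pow s (F n l))"
        by (rule suminf_finite) (auto simp: F_def diam_pow_def)
      also have "\<dots> \<le> (\<Sum>l<?k. ennreal ((c * r ^ (n + N)) powr s))"
      proof (rule sum_mono)
        fix l assume "l \<in> {..<?k}"
        then have "F n l \<in> \<U> (n + N)" using F_in by simp
        then have "diameter (F n l) powr s \<le> (c * r ^ (n + N)) powr s"
          using diam bdd s(1) by (intro powr_mono2) (auto simp: diameter_ge_0)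
        then show "diam_pow s (F n l) \<le> ennreal ((c * r ^ (n + N)) powr s)"
          using s(1) by (auto simp: diam_pow_def ennreal_leI)
      qed
      also have "\<dots> = ennreal (real ?k * (c * r ^ (n + N)) powr s)"
        by (simp add: ennreal_mult' ennreal_of_nat_eq_real_of_nat)
      also have "\<dots> \<le> ennreal (C * q ^ (n + N) * (c * r ^ (n + N)) powr s)"
        by (intro ennreal_leI mult_right_mono card) simp
      also have "C * q ^ (n + N) * (c * r ^ (n + N)) powr s = a (n + N)"
      proof -
        have "(r ^ (n + N)) powr s = (r powr s) ^ (n + N)"
          using r(1) by (simp add: powr_powr mult.commute flip: powr_realpow)
        then show ?thesis
          using c r(1) by (simp add: a_def powr_mult power_mult_distrib)
      qed
      finally show "(\<Sum>l. diam_pow s (F n l)) \<le> ennreal (a (n + N))" .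
    qed auto
    also have "\<dots> = ennreal (\<Sum>n. a (n + N))"
      using a_sum a_nonneg by (intro suminf_ennreal2) auto
    also have "\<dots> \<le> ennreal \<epsilon>" using N\<epsilon> by (intro ennreal_leI) simp
    finally show ?thesis .
  qed
  then have "hausdorff_premeasure s \<delta> A \<le> 0"
    using ennreal_le_epsilon[of 0 "hausdorff_premeasure s \<delta> A"] by simp
  then show ?thesis by simp
qed

lemma hausdorff_dim_limsup_le:
  fixes A :: "'a::metric_space set" and \<U> :: "nat \<Rightarrow> 'a set set"
  assumes "\<And>n. finite (\<U> n)" "\<And>n. real (card (\<U> n)) \<le> C * q ^ n"
    and "\<And>n U. U \<in> \<U> n \<Longrightarrow> bounded U" "\<And>n U. U \<in> \<U> n \<Longrightarrow> diameter U \<le> c * r ^ n"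
    and "\<And>x. x \<in> A \<Longrightarrow> \<exists>\<^sub>\<infinity>n. x \<in> \<Union>(\<U> n)"
    and "0 \<le> C" "0 < c" and q: "1 \<le> q" and r: "0 < r" "r < 1"
  shows "hausdorff_dim A \<le> ereal (log 2 q / (- log 2 r))"
proof (rule ereal_le_epsilon2)
  fix e :: real assume e: "0 < e"
  let ?s = "log 2 q / (- log 2 r) + e"
  have lr: "log 2 r < 0" and lq: "0 \<le> log 2 q" using q r by auto
  \<comment> \<open>Here \<open>1 <= q\<close> enters: \<open>?s\<close> is strictly positive, so it
    is admissible in \<open>hausdorff_dim\<close> and the special convention for exponent 0 never
    arises.\<close>
  have "0 \<le> log 2 q / (- log 2 r)" using lr lq by (intro divide_nonneg_pos) linarith+
  then have s: "0 < ?s" using e by linarith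
  \<comment> \<open>At the critical exponent the ratio is exactly 1; the surplus \<open>e\<close>
    contributes the factor \<open>r powr e\<close>, which is below 1.\<close>
  have "log 2 (q * r powr ?s) = log 2 q + ?s * log 2 r"
    using q r by (subst log_mult) (auto simp: log_powr)
  also have "\<dots> = e * log 2 r" using lr by (simp add: field_simps)
  also have "\<dots> < 0" using e lr by (simp add: mult_pos_neg)
  finally have "q * r powr ?s < 1" using q r by (subst (asm) log_less_zero_cancel_iff) auto
  then have "hausdorff_premeasure ?s \<delta> A = 0" if "0 < \<delta>" for \<delta>
    using hausdorff_premeasure_limsup_eq_0[OF assms(1-7) _ r s _ that] q by simp
  then have "hausdorff_measure ?s A = 0"
    by (simp add: hausdorff_measure_def)
  then show "hausdorff_dim A \<le> ereal (log 2 q / (- log 2 r)) + ereal e"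
    unfolding hausdorff_dim_def using s
    by (intro Inf_lower CollectI exI[of _ ?s]) (simp add: less_imp_le)
qed

section \<open>Covering slabs by tubes and projecting slabs to lines\<close>

lemma tube_nullI_finite:
  fixes K :: "'a::euclidean_space set"
  assumes "\<And>\<epsilon>. 0 < \<epsilon> \<Longrightarrow> \<exists>\<T> w. finite \<T> \<and> (\<forall>T\<in>\<T>. is_tube w T) \<and> K \<subseteq> \<Union>\<T> \<and>
    real (card \<T>) * w ^ (DIM('a) - 1) < \<epsilon>"
  shows "tube_null K"
  unfolding tube_null_def
proof (intro allI impI)
  fix \<epsilon> :: real assume "0 < \<epsilon>"
  from assms[OF this] obtain \<T> :: "'a set set" and w where T: "finite \<T>" "\<forall>T\<in>\<T>. is_tube w T" "K \<subseteq> \<Union>\<T>"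
    "real (card \<T>) * w ^ (DIM('a) - 1) < \<epsilon>" by blast
  obtain e where e: "bij_betw e {..<card \<T>} \<T>"
    using ex_bij_betw_nat_finite[OF T(1)] by (auto simp: atLeast0LessThan)
  show "\<exists>(I :: nat set) T w. (\<forall>i\<in>I. is_tube (w i) (T i)) \<and> K \<subseteq> (\<Union>i\<in>I. T i) \<and>
      (\<lambda>i. w i ^ (DIM('a) - 1)) summable_on I \<and> (\<Sum>\<^sub>\<infinity>i\<in>I. w i ^ (DIM('a) - 1)) < \<epsilon>"
  proof (intro exI conjI)
    show "\<forall>i\<in>{..<card \<T>}. is_tube w (e i)" using T(2) bij_betwE[OF e] by blast
    show "K \<subseteq> (\<Union>i\<in>{..<card \<T>}. e i)" using T(3) bij_betw_imp_surj_on[OF e] by simp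
  qed (use T(4) in auto)
qed

lemma slab_tube_cover:
  fixes v :: "'a::euclidean_space" and w p R :: real
  assumes v: "norm v = 1" and d: "DIM('a) \<ge> 2" and w: "0 < w" "w \<le> 2 * R"
  shows "\<exists>\<T>. finite \<T> \<and> (\<forall>T\<in>\<T>. is_tube w T) \<and>
    real (card \<T>) * w ^ (DIM('a) - 2) \<le> ((4 * DIM('a) + 6) * R) ^ (DIM('a) - 2) \<and>
    {x. norm x \<le> R \<and> \<bar>x \<bullet> v - p\<bar> \<le> w / 2} \<subseteq> \<Union>\<T>"
proof -
  obtain B where B: "v \<in> B" "pairwise orthogonal B" "\<And>b. b \<in> B \<Longrightarrow> norm b = 1"
    "independent B" "card B = DIM('a)" "span B = UNIV"
    using vector_in_orthonormal_basis[OF v] by blast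
  have finB: "finite B" using B(4) by (rule independent_imp_finite)
  have expand: "(\<Sum>b\<in>B. (x \<bullet> b) *\<^sub>R b) = x" for x
    using orthonormal_basis_expand[OF B(2,3) _ finB] B(6) by blast
  have "card (B - {v}) \<noteq> 0" using B d finB by simp
  then obtain u where u: "u \<in> B" "u \<noteq> v"
    by (metis Diff_iff all_not_in_conv card.empty insertI1)
  define B' where "B' = B - {v} - {u}"
  have B': "finite B'" "card B' = DIM('a) - 2" "\<And>b. b \<in> B' \<Longrightarrow> norm b = 1"
    using finB B u by (auto simp: B'_def)
  have split: "x = (x \<bullet> v) *\<^sub>R v + ((x \<bullet> u) *\<^sub>R u + (\<Sum>b\<in>B'. (x \<bullet> b) *\<^sub>R b))" for x
  proof -
    have "(\<Sum>b\<in>B. (x \<bullet> b) *\<^sub>R b)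
      = (x \<bullet> v) *\<^sub>R v + ((x \<bullet> u) *\<^sub>R u + (\<Sum>b\<in>B'. (x \<bullet> b) *\<^sub>R b))"
      unfolding B'_def using finB B(1) u by (simp add: sum.remove[of B v] sum.remove[of "B - {v}" u])
    then show ?thesis by (simp add: expand)
  qed
  \<comment> \<open>With this mesh the rounding errors in fewer than \<open>DIM('a)\<close>
    directions add up to less than \<open>w / 2\<close>, leaving \<open>w / 2\<close> for the
    half-thickness of the slab.\<close>
  define \<delta> where "\<delta> = w / (2 * DIM('a))"
  have \<delta>: "0 < \<delta>" using w by (simp add: \<delta>_def)
  define M where "M = \<lceil>R / \<delta>\<rceil>"
  have "0 \<le> R / \<delta>" using w \<delta> by simp
  then have M: "0 \<le> M" unfolding M_def by linarith
  define c where "c k = p *\<^sub>R v + (\<Sum>b\<in>B'. (\<delta> * of_int (k b)) *\<^sub>R b)" for k :: "'a \<Rightarrow> int"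
  define T where "T k = {x. infdist x (affine hull {c k, c k + u}) < w}" for k
  define P where "P = B' \<rightarrow>\<^sub>E {- M..M}"
  have finP: "finite P" unfolding P_def using B' by (intro finite_PiE) auto
  have "u \<noteq> 0" using B(3)[OF u(1)] by auto
  then have tube: "is_tube w (T k)" for k
    unfolding is_tube_def T_def using w
    by (auto intro!: exI[of _ "affine hull {c k, c k + u}"] simp: affine_affine_hull aff_dim_2)
  have card: "real (card (T ` P)) * w ^ (DIM('a) - 2) \<le> ((4 * DIM('a) + 6) * R) ^ (DIM('a) - 2)"
  proof -
    have "real (card (T ` P)) \<le> real (card P)" using card_image_le[OF finP] by simp
    also have "\<dots> = real_of_int (2 * M + 1) ^ (DIM('a) - 2)"
      using M B' by (simp add: P_def card_PiE)
    finally have "real (card (T ` P)) * w ^ (DIM('a) - 2)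
      \<le> real_of_int (2 * M + 1) ^ (DIM('a) - 2) * w ^ (DIM('a) - 2)"
      using w by (intro mult_right_mono) auto
    also have "\<dots> = (real_of_int (2 * M + 1) * w) ^ (DIM('a) - 2)"
      by (simp add: power_mult_distrib)
    also have "\<dots> \<le> ((4 * DIM('a) + 6) * R) ^ (DIM('a) - 2)"
    proof (rule power_mono)
      \<comment> \<open>Rounding up costs at most 1, which yields the summand \<open>3 * w\<close>;
        the bound \<open>w <= 2 * R\<close> turns it into \<open>6 * R\<close>.\<close>
      have "of_int M \<le> R / \<delta> + 1" by (simp add: M_def)
      then have "real_of_int (2 * M + 1) * w \<le> (2 * (R / \<delta>) + 3) * w"
        using w by (intro mult_right_mono) auto
      also have "\<dots> = 4 * DIM('a) * R + 3 * w" using w by (simp add: \<delta>_def field_simps)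
      finally show "real_of_int (2 * M + 1) * w \<le> (4 * DIM('a) + 6) * R"
        using w by (simp add: algebra_simps)
    qed (use M w in simp)
    finally show ?thesis .
  qed
  have "x \<in> \<Union>(T ` P)" if x: "norm x \<le> R" "\<bar>x \<bullet> v - p\<bar> \<le> w / 2" for x
  proof -
    define k where "k = (\<lambda>b\<in>B'. \<lfloor>(x \<bullet> b) / \<delta>\<rfloor>)"
    have "k \<in> P"
      unfolding P_def k_def
    proof (rule restrict_PiE_iff[THEN iffD2], intro ballI)
      fix b assume b: "b \<in> B'"
      have "\<bar>x \<bullet> b\<bar> \<le> R" using Cauchy_Schwarz_ineq2[of x b] B'(3)[OF b] x(1) by simp
      then have "\<bar>(x \<bullet> b) / \<delta>\<bar> \<le> R / \<delta>" using \<delta> by (simp add: divide_right_mono)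
      then have "- (R / \<delta>) \<le> (x \<bullet> b) / \<delta>" "(x \<bullet> b) / \<delta> \<le> R / \<delta>" by linarith+
      then show "\<lfloor>(x \<bullet> b) / \<delta>\<rfloor> \<in> {- M..M}"
        unfolding M_def atLeastAtMost_iff by (intro conjI; linarith)
    qed
    moreover have "x \<in> T k"
    proof -
      \<comment> \<open>This point of the axis has the same \<open>u\<close>-coordinate as
        \<open>x\<close>, so only the \<open>v\<close>-direction and the grid directions contribute
        to the distance.\<close>
      let ?y = "c k + (x \<bullet> u) *\<^sub>R u"
      have mem: "?y \<in> affine hull {c k, c k + u}"
        unfolding affine_hull_2 mem_Collect_eq
        by (intro exI[of _ "1 - x \<bullet> u"] exI[of _ "x \<bullet> u"]) (simp add: algebra_simps)
      have "x - ?y = (x \<bullet> v - p) *\<^sub>R v + (\<Sum>b\<in>B'. (x \<bullet> b - \<delta> * of_int (k b)) *\<^sub>R b)"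
        by (subst (1) split[of x]) (simp add: c_def scaleR_diff_left sum_subtractf)
      also have "norm \<dots> \<le> \<bar>x \<bullet> v - p\<bar> + (\<Sum>b\<in>B'. \<bar>x \<bullet> b - \<delta> * of_int (k b)\<bar>)"
        using v B'(3) by (intro order.trans[OF norm_triangle_ineq] add_mono order.trans[OF norm_sum])
          auto
      also have "\<dots> \<le> w / 2 + (\<Sum>b\<in>B'. \<delta>)"
      proof (intro add_mono sum_mono x(2))
        fix b assume "b \<in> B'"
        then have kb: "k b = \<lfloor>(x \<bullet> b) / \<delta>\<rfloor>" by (simp add: k_def)
        have "of_int (k b) \<le> (x \<bullet> b) / \<delta>" "(x \<bullet> b) / \<delta> < of_int (k b) + 1"
          unfolding kb by linarith+
        then show "\<bar>x \<bullet> b - \<delta> * of_int (k b)\<bar> \<le> \<delta>"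
          using \<delta> by (simp add: field_simps abs_le_iff)
      qed
      also have "\<dots> < w"
      proof -
        have "real (DIM('a) - 2) < real DIM('a)" using d by simp
        then have "real (DIM('a) - 2) * \<delta> < real DIM('a) * \<delta>" using \<delta> by simp
        also have "\<dots> = w / 2" by (simp add: \<delta>_def)
        finally show ?thesis unfolding sum_constant B'(2) by linarith
      qed
      finally have "dist x ?y < w" by (simp add: dist_norm)
      then show ?thesis using infdist_le[OF mem, of x] by (simp add: T_def)
    qed
    ultimately show ?thesis by blast
  qed
  then show ?thesis using tube card finP by (intro exI[of _ "T ` P"]) auto
qed

text \<open>For a unit vector \<open>v\<close> the projection carries a slab to a segment of length
  \<open>2 * R * r ^ n\<close>, so the limsup bound applies with these segments as covering
  sets.\<close>

lemma hausdorff_dim_line_proj_limsup_slabs_le: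
  fixes v :: "'a::euclidean_space" and P :: "nat \<Rightarrow> real set"
  assumes v: "norm v = 1" and fin: "\<And>n. finite (P n)" and card: "\<And>n. real (card (P n)) \<le> C * q ^ n"
    and cover: "\<And>x. x \<in> A \<Longrightarrow> \<exists>\<^sub>\<infinity>n. \<exists>p\<in>P n. \<bar>x \<bullet> v - p\<bar> \<le> R * r ^ n"
    and "0 \<le> C" "0 < R" "1 \<le> q" "0 < r" "r < 1"
  shows "hausdorff_dim (line_proj v ` A) \<le> ereal (log 2 q / (- log 2 r))"
proof (rule hausdorff_dim_limsup_le)
  define S where "S n p = line_proj v ` {x. \<bar>x \<bullet> v - p\<bar> \<le> R * r ^ n}" for n p
  have lp: "line_proj v x = (x \<bullet> v) *\<^sub>R v" for x using v by (simp add: line_proj_def norm_eq_1)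
  show "finite (S n ` P n)" for n using fin by simp
  show "real (card (S n ` P n)) \<le> C * q ^ n" for n
    using card_image_le[OF fin[of n], of "S n"] card[of n] by linarith
  show "bounded U" if U: "U \<in> S n ` P n" for n U
  proof -
    obtain p where p: "U = S n p" using U by blast
    have "dist (p *\<^sub>R v) y \<le> R * r ^ n" if "y \<in> U" for y
      using that v unfolding p S_def
      by (auto simp: lp dist_norm abs_minus_commute simp flip: scaleR_diff_left)
    then show ?thesis unfolding bounded_def by blast
  qed
  show "diameter U \<le> (2 * R) * r ^ n" if U: "U \<in> S n ` P n" for n U
  proof -
    obtain p where p: "U = S n p" using U by blast
    show ?thesis unfolding p
    proof (rule diameter_le)
      show "S n p \<noteq> {} \<or> 0 \<le> 2 * R * r ^ n" using assms by simp
      fix x y assume "x \<in> S n p" "y \<in> S n p"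
      then show "norm (x - y) \<le> 2 * R * r ^ n"
        using v unfolding S_def by (auto simp: lp simp flip: scaleR_diff_left)
    qed
  qed
  show "\<exists>\<^sub>\<infinity>n. y \<in> \<Union>(S n ` P n)" if "y \<in> line_proj v ` A" for y
  proof -
    obtain x where x: "x \<in> A" "y = line_proj v x" using \<open>y \<in> line_proj v ` A\<close> by blast
    show ?thesis using cover[OF x(1)] by (rule INFM_mono) (auto simp: S_def x(2))
  qed
qed (use assms in auto)

lemma ex_unit_vector_inner_eq:
  fixes a b :: "'a::euclidean_space"
  assumes "DIM('a) \<ge> 2"
  obtains v where "norm v = 1" "a \<bullet> v = b \<bullet> v"
proof -
  obtain y where y: "y \<noteq> 0" "orthogonal (a - b) y"
    using orthogonal_to_vector_exists[OF assms] by blast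
  show ?thesis
    by (rule that[of "y /\<^sub>R norm y"]) (use y in \<open>auto simp: orthogonal_def inner_diff_left\<close>)
qed

section \<open>Directions, dimension bound and tube-nullness of the attractor\<close>

theorem proposition1p3:
  fixes m :: nat and r :: real
    and lam :: "nat \<Rightarrow> real ^ 'n" and K :: "(real ^ 'n) set"
  assumes "CARD('n) \<ge> 2" and "m \<ge> 2" and "0 < r" and "r < 1"
    and "is_attractor {0..<m} (\<lambda>i x. r *\<^sub>R x + lam i) K"
    and "- log 2 r > log 2 (real m) - 2 / real m"
  shows "(\<exists>(V :: (real ^ 'n) set) E.
            finite V \<and> V \<subseteq> UNIV - {0} \<and> K \<subseteq> (\<Union>v\<in>V. E v) \<and>
            (\<forall>v\<in>V. hausdorff_dim (line_proj v ` E v)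
                     \<le> ereal ((log 2 (real m) - 2 / real m) / (- log 2 r))))
         \<and> (log 2 (real m) - 2 / real m) / (- log 2 r) < 1
         \<and> tube_null K"
proof (intro conjI)
  have d: "DIM(real ^ 'n) \<ge> 2" using assms(1) by simp
  have lr: "log 2 r < 0" using assms by simp
  define q where "q = real m * 2 powr (- 2 / real m)"
  have logq: "log 2 q = log 2 (real m) - 2 / real m"
    using assms(2) by (simp add: q_def log_mult)
  \<comment> \<open>The chain \<open>2 powr (2 / m) <= 2 <= m\<close> gives
    \<open>1 <= q\<close>.\<close>
  have "2 powr (2 / real m) \<le> 2 powr 1" using assms(2) by (intro powr_mono) auto
  then have q1: "1 \<le> q" using assms(2) by (simp add: q_def powr_minus field_simps)
  have "log 2 (q * r) < 0" using assms q1 by (simp add: log_mult logq)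
  then have qr: "q * r < 1" using assms q1 by (subst (asm) log_less_zero_cancel_iff) auto
  have "bounded K" using assms(5) by (simp add: is_attractor_def compact_imp_bounded)
  then obtain R where R: "0 < R" "\<And>y. y \<in> K \<Longrightarrow> norm y \<le> R"
    using bounded_pos by blast
  note word = attractor_merged_word[OF assms(5,2) _ assms(3) R(2)]

  have "\<exists>v. norm v = 1 \<and> lam i \<bullet> v = lam j \<bullet> v" for i j
    using ex_unit_vector_inner_eq[OF d, of "lam i" "lam j"] by blast
  then obtain vec where vec: "\<And>i j. norm (vec i j) = 1" "\<And>i j. lam i \<bullet> vec i j = lam j \<bullet> vec i j"
    by metis

  show "(log 2 (real m) - 2 / real m) / (- log 2 r) < 1"
    using assms(6) lr by (subst pos_divide_less_eq) auto

  show "\<exists>(V :: (real ^ 'n) set) E.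
    finite V \<and> V \<subseteq> UNIV - {0} \<and> K \<subseteq> (\<Union>v\<in>V. E v) \<and>
    (\<forall>v\<in>V. hausdorff_dim (line_proj v ` E v)
      \<le> ereal ((log 2 (real m) - 2 / real m) / (- log 2 r)))"
  proof -
    define V where "V = (\<lambda>(i, j). vec i j) ` ({0..<m} \<times> {0..<m})"
    \<comment> \<open>All merged words are used for every \<open>v\<close>, not only those whose
      pair is identified by \<open>v\<close>; the common bound \<open>m ^ 2 * q ^ n\<close> is good
      enough.\<close>
    define P where "P v n = (\<lambda>(i, j, w). word_shift r lam w \<bullet> v) ` merged_words m n" for v n
    define E where "E v = {x \<in> K. \<exists>\<^sub>\<infinity>n. \<exists>p\<in>P v n. \<bar>x \<bullet> v - p\<bar> \<le> R * r ^ n}" for v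
    have finV: "finite V" by (simp add: V_def)
    have normV: "norm v = 1" if "v \<in> V" for v using that vec by (auto simp: V_def)
    have "x \<in> (\<Union>v\<in>V. E v)" if x: "x \<in> K" for x
    proof -
      have "\<exists>v\<in>V. \<exists>p\<in>P v n. \<bar>x \<bullet> v - p\<bar> \<le> R * r ^ n" for n
      proof -
        obtain i j w where w: "(i, j, w) \<in> merged_words m n"
          and est: "\<And>v. norm v = 1 \<Longrightarrow> lam i \<bullet> v = lam j \<bullet> v \<Longrightarrow>
            \<bar>x \<bullet> v - word_shift r lam w \<bullet> v\<bar> \<le> R * r ^ n"
          using word[OF x, of n] by blast
        have "vec i j \<in> V" using w by (auto simp: merged_words_def V_def)
        moreover have "word_shift r lam w \<bullet> vec i j \<in> P (vec i j) n"
          using w by (force simp: P_def)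
        ultimately show ?thesis using est[OF vec] by blast
      qed
      \<comment> \<open>Some direction works at every level; as \<open>V\<close> is finite, by
        pigeonhole one direction works at infinitely many levels, which puts \<open>x\<close> into
        its \<open>E v\<close>.\<close>
      then have "\<exists>\<^sub>\<infinity>n. \<exists>v\<in>V. \<exists>p\<in>P v n. \<bar>x \<bullet> v - p\<bar> \<le> R * r ^ n" by simp
      then show ?thesis
        unfolding INFM_finite_Bex_distrib[OF finV] E_def using x by blast
    qed
    moreover have "hausdorff_dim (line_proj v ` E v) \<le> ereal (log 2 q / (- log 2 r))"
      if "v \<in> V" for v
    proof (rule hausdorff_dim_line_proj_limsup_slabs_le[where P = "P v" and C = "real (m ^ 2)"])
      show "finite (P v n)" for n by (simp add: P_def finite_merged_words)
      show "real (card (P v n)) \<le> real (m ^ 2) * q ^ n" for n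
      proof -
        have "card (P v n) \<le> card (merged_words m n)"
          unfolding P_def by (rule card_image_le[OF finite_merged_words])
        then show ?thesis using card_merged_words[of m n] unfolding q_def by linarith
      qed
    qed (use normV[OF that] R q1 assms in \<open>auto simp: E_def\<close>)
    moreover have "V \<subseteq> UNIV - {0}" using normV by force
    ultimately show ?thesis
      using finV by (intro exI[of _ V] exI[of _ E]) (auto simp: logq)
  qed

  show "tube_null K"
  proof (rule tube_nullI_finite)
    fix \<epsilon> :: real assume \<epsilon>: "0 < \<epsilon>"
    let ?d = "DIM(real ^ 'n)"
    define C where "C = ((4 * ?d + 6) * R) ^ (?d - 2)"
    have C: "0 \<le> C" using R by (simp add: C_def)
    \<comment> \<open>This will be the total cost at level \<open>n\<close>: at most
      \<open>m ^ 2 * q ^ n\<close> slabs, each costing at most \<open>C * w\<close> with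
      \<open>w = 2 * R * r ^ n\<close>. For tube-nullness a single large level suffices.\<close>
    have "(\<lambda>n. real (m ^ 2) * C * (2 * R) * (q * r) ^ n) \<longlonglongrightarrow> 0"
      using qr q1 assms by (intro tendsto_mult_right_zero LIMSEQ_realpow_zero) auto
    then have "\<forall>\<^sub>F n in sequentially. real (m ^ 2) * C * (2 * R) * (q * r) ^ n < \<epsilon>"
      using \<epsilon> by (simp add: order_tendsto_iff)
    then obtain n where n: "real (m ^ 2) * C * (2 * R) * (q * r) ^ n < \<epsilon>"
      by (auto simp: eventually_sequentially)
    \<comment> \<open>Then \<open>w / 2\<close> is exactly the projection error of
      \<open>attractor_merged_word\<close>.\<close>
    define w where "w = 2 * R * r ^ n"
    have w: "0 < w" "w \<le> 2 * R" using R assms by (auto simp: w_def mult_le_cancel_left1 power_le_one)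
    define Q where "Q v p \<T> \<longleftrightarrow> finite \<T> \<and> (\<forall>T\<in>\<T>. is_tube w T) \<and>
      real (card \<T>) * w ^ (?d - 2) \<le> C \<and>
      {x. norm x \<le> R \<and> \<bar>x \<bullet> v - p\<bar> \<le> w / 2} \<subseteq> \<Union>\<T>" for v :: "real ^ 'n" and p \<T>
    have "\<exists>\<T>. Q v p \<T>" if "norm v = 1" for v p
      using slab_tube_cover[OF that d w, of p] unfolding Q_def C_def .
    then obtain \<T> where "\<And>v p. norm v = 1 \<Longrightarrow> Q v p (\<T> v p)" by metis
    note \<T> = this[unfolded Q_def]
    define F where "F = (\<lambda>(i, j, u). \<T> (vec i j) (word_shift r lam u \<bullet> vec i j))"
    let ?\<F> = "\<Union>z\<in>merged_words m n. F z"
    have "K \<subseteq> \<Union>?\<F>"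
    proof
      fix x assume x: "x \<in> K"
      obtain i j u where u: "(i, j, u) \<in> merged_words m n"
        and est: "\<And>v. norm v = 1 \<Longrightarrow> lam i \<bullet> v = lam j \<bullet> v \<Longrightarrow>
          \<bar>x \<bullet> v - word_shift r lam u \<bullet> v\<bar> \<le> R * r ^ n"
        using word[OF x, of n] by blast
      have "x \<in> \<Union>(F (i, j, u))"
        using \<T>[OF vec(1), of i j "word_shift r lam u \<bullet> vec i j"] R(2)[OF x] est[OF vec]
        by (auto simp: F_def w_def)
      with u show "x \<in> \<Union>?\<F>" by blast
    qed
    moreover have "real (card ?\<F>) * w ^ (?d - 1) < \<epsilon>"
    proof -
      have F: "real (card (F z)) * w ^ (?d - 2) \<le> C" for z
        using \<T> vec by (auto simp: F_def split: prod.split)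
      have "real (card ?\<F>) \<le> (\<Sum>z\<in>merged_words m n. real (card (F z)))"
        using card_UN_le[OF finite_merged_words[of m n], of F] by (simp flip: of_nat_sum)
      then have "real (card ?\<F>) * w ^ (?d - 2)
        \<le> (\<Sum>z\<in>merged_words m n. real (card (F z)) * w ^ (?d - 2))"
        using w by (simp add: mult_right_mono flip: sum_distrib_right)
      also have "\<dots> \<le> (\<Sum>z\<in>merged_words m n. C)" by (intro sum_mono F)
      also have "\<dots> = real (card (merged_words m n)) * C" by simp
      also have "\<dots> \<le> real (m ^ 2) * q ^ n * C"
        using card_merged_words[of m n] C unfolding q_def by (rule mult_right_mono)
      finally have "real (card ?\<F>) * w ^ (?d - 2) * w \<le> real (m ^ 2) * q ^ n * C * w"
        using w by (intro mult_right_mono) auto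
      also have "\<dots> = real (m ^ 2) * C * (2 * R) * (q * r) ^ n"
        by (simp add: w_def power_mult_distrib)
      also have "\<dots> < \<epsilon>" by (rule n)
      finally have total: "real (card ?\<F>) * w ^ (?d - 2) * w < \<epsilon>" .
      \<comment> \<open>The power \<open>w ^ (?d - 2)\<close> is absorbed by the number of tubes per
        slab; the one remaining factor \<open>w\<close> supplies \<open>r ^ n\<close> against
        \<open>q ^ n\<close>. With truncated subtraction this splitting needs
        \<open>?d >= 2\<close>.\<close>
      have exponent: "?d - 1 = Suc (?d - 2)" using d by linarith
      show ?thesis
        using total unfolding exponent power_Suc2 mult.assoc .
    qed
    moreover have "finite (F z) \<and> (\<forall>T\<in>F z. is_tube w T)" for z
      using \<T>[OF vec(1)] by (cases z) (simp add: F_def)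
    ultimately show "\<exists>\<T> w. finite \<T> \<and> (\<forall>T\<in>\<T>. is_tube w T) \<and> K \<subseteq> \<Union>\<T> \<and>
      real (card \<T>) * w ^ (?d - 1) < \<epsilon>"
      using finite_merged_words[of m n] by (intro exI[of _ ?\<F>] exI[of _ w]) blast
  qed
qed

end
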